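(* Suppose that $\sum_{n=0}^\infty a_n^{-1}<\infty$, that $\beta_n\to\beta_\infty\in\mathbb R$ as $n\to\infty$ with $|\beta_\infty|>1$, that $\sum_n |k_n-1|<\infty$, and that $\sum_n|\beta_{n+1}-\beta_n|<\infty$. Then for all $z\in\mathbb C$ the solution $g_n(z)$ of the Jacobi equation defined by $$g_n(z)=f_n(z)\sum_{m=n_0}^n\big(a_{m-1}f_{m-1}(z)f_m(z)\big)^{-1},\qquad n\ge n_0,$$ satisfies $$\lim_{n\to\infty}\sqrt{a_n}\,e^{-\varphi_n}(\operatorname{sgn}\beta_\infty)^ng_n(z)=\frac{\operatorname{sgn}\beta_\infty}{2\sqrt{\beta_\infty^2-1}}\,\varkappa_\infty .$$
   Context: $\mathbb Z_+=\{0,1,2,\dots\}$. The coefficients satisfy $a_n>0$, $b_n\in\mathbb R$ for $n\in\mathbb Z_+$, and by convention $a_{-1}=1/2$. Notation: $$\beta_n=-\frac{b_n}{2\sqrt{a_{n-1}a_n}},\qquad k_n=\frac{a_n}{\sqrt{a_{n-1}a_{n+1}}},\qquad \varkappa_n=\sqrt{\frac{a_{n+1}}{a_n}},\qquad \varkappa_\infty=\lim_{n\to\infty}\varkappa_n$$ (this limit exists and is finite under the hypotheses). The phase is $\varphi_n=\sum_m\operatorname{arccosh}|\beta_m|$, the sum being over those $m\in\{0,\dots,n-1\}$ with $|\beta_m|\ge1$. The Jacobi equation is $a_{n-1}F_{n-1}+b_nF_n+a_nF_{n+1}=zF_n$, $n\in\mathbb Z_+$, for sequences $(F_n)_{n\ge-1}$.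 The Jost solution $f_n(z)$ is its unique solution with $f_n(z)=a_n^{-1/2}(\operatorname{sgn}\beta_\infty)^ne^{-\varphi_n}(1+o(1))$ as $n\to\infty$. In particular $f_n(z)\neq0$ for large $n$, and $n_0=n_0(z)\ge 1$ is chosen so that $f_n(z)\ne0$ for all $n\ge n_0-1$. *)

theory Defs
  imports Complex_Main "HOL-Library.Landau_Symbols"
begin

text \<open>
  The off-diagonal coefficients and the solutions of the Jacobi equation are indexed by
  \<open>n \<ge> -1\<close> and are therefore functions on \<^typ>\<open>int\<close>; values at
  indices below \<open>-1\<close> are never used. The convention \<open>a (-1) = 1/2\<close> is part of
  \<open>jacobi_coeffs\<close>.
\<close>

definition jacobi_coeffs :: "(int \<Rightarrow> real) \<Rightarrow> bool" where
  "jacobi_coeffs a \<longleftrightarrow> a (-1) = 1/2 \<and> (\<forall>n::nat. a (int n) > 0)"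

definition jbeta :: "(int \<Rightarrow> real) \<Rightarrow> (nat \<Rightarrow> real) \<Rightarrow> nat \<Rightarrow> real" where
  "jbeta a b n = - b n / (2 * sqrt (a (int n - 1) * a (int n)))"

definition jk :: "(int \<Rightarrow> real) \<Rightarrow> nat \<Rightarrow> real" where
  "jk a n = a (int n) / sqrt (a (int n - 1) * a (int n + 1))"

definition varkappa :: "(int \<Rightarrow> real) \<Rightarrow> nat \<Rightarrow> real" where
  "varkappa a n = sqrt (a (int n + 1) / a (int n))"

definition varkappa_inf :: "(int \<Rightarrow> real) \<Rightarrow> real" where
  "varkappa_inf a = lim (varkappa a)"

definition phase :: "(int \<Rightarrow> real) \<Rightarrow> (nat \<Rightarrow> real) \<Rightarrow> nat \<Rightarrow> real" where
  "phase a b n = (\<Sum>m | m < n \<and> \<bar>jbeta a b m\<bar> \<ge> 1. arcosh \<bar>jbeta a b m\<bar>)"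

definition jacobi_solution ::
  "(int \<Rightarrow> real) \<Rightarrow> (nat \<Rightarrow> real) \<Rightarrow> complex \<Rightarrow> (int \<Rightarrow> complex) \<Rightarrow> bool" where
  "jacobi_solution a b z F \<longleftrightarrow>
     (\<forall>n::nat. of_real (a (int n - 1)) * F (int n - 1) + of_real (b n) * F (int n)
        + of_real (a (int n)) * F (int n + 1) = z * F (int n))"

text \<open>\<open>\<beta>\<close> stands for the limit of \<^const>\<open>jbeta\<close>.\<close>

definition jost_solution ::
  "(int \<Rightarrow> real) \<Rightarrow> (nat \<Rightarrow> real) \<Rightarrow> real \<Rightarrow> complex \<Rightarrow> (int \<Rightarrow> complex) \<Rightarrow> bool" where
  "jost_solution a b \<beta> z f \<longleftrightarrow> jacobi_solution a b z f \<and>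
     (\<lambda>n::nat. f (int n)) \<sim>[sequentially]
       (\<lambda>n. of_real (a (int n) powr (-1/2) * sgn \<beta> ^ n * exp (- phase a b n)))"

text \<open>
  The explicit formula gives \<open>g n\<close> only for \<open>n \<ge> n0\<close>; the remaining values are
  those forced by the Jacobi equation.
\<close>

definition second_solution ::
  "(int \<Rightarrow> real) \<Rightarrow> (nat \<Rightarrow> real) \<Rightarrow> complex \<Rightarrow> (int \<Rightarrow> complex) \<Rightarrow> nat \<Rightarrow> (int \<Rightarrow> complex) \<Rightarrow> bool"
where
  "second_solution a b z f n0 g \<longleftrightarrow> jacobi_solution a b z g \<and>
     (\<forall>n\<ge>n0. g (int n) = f (int n) *
        (\<Sum>m=n0..n. inverse (of_real (a (int m - 1)) * f (int m - 1) * f (int m))))"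

end

theory Submission
  imports Defs "HOL-Analysis.Infinite_Products"
begin

text \<open>
  Put \<open>\<theta>\<^sub>n = \<phi>\<^sub>n\<^sub>+\<^sub>1 - \<phi>\<^sub>n\<close>, which tends to \<open>\<theta> = arcosh \<bar>\<beta>\<bar> > 0\<close>, and let \<open>S\<^sub>n\<close> be the sum
  defining \<open>g\<^sub>n = f\<^sub>n S\<^sub>n\<close>. The asymptotics of the Jost solution turn \<open>x\<^sub>n = exp (-2 \<phi>\<^sub>n) S\<^sub>n\<close> into a
  solution of the recurrence \<open>x\<^sub>n\<^sub>+\<^sub>1 = exp (-2 \<theta>\<^sub>n) x\<^sub>n + w\<^sub>n\<close> whose inhomogeneity tends to
  \<open>w = sgn \<beta> \<cdot> \<kappa> \<cdot> exp (-\<theta>)\<close>, where \<open>\<kappa>\<close> is the limit of \<^const>\<open>varkappa\<close>. Such a contracting recurrence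
  forces \<open>x\<^sub>n\<close> to converge to \<open>w / (1 - exp (-2 \<theta>)) = sgn \<beta> \<cdot> \<kappa> / (2 sinh \<theta>)\<close>.
\<close>

section \<open>Recurrences with a contracting limit\<close>

lemma tendsto_zero_of_contraction:
  fixes y e :: "nat \<Rightarrow> real"
  assumes "\<And>n. 0 \<le> y n" and "0 \<le> q" "q < 1"
    and step: "eventually (\<lambda>n. y (Suc n) \<le> q * y n + e n) sequentially"
    and "e \<longlonglongrightarrow> 0"
  shows "y \<longlonglongrightarrow> 0"
proof (rule LIMSEQ_I)
  fix r :: real assume "0 < r"
  \<comment> \<open>This choice makes \<open>r / 2\<close> the fixed point of the map taking
    \<open>y\<close> to \<open>q * y + d\<close>; the other half of \<open>r\<close> is left for the
    decaying term \<open>q ^ k * y N\<close>.\<close>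
  define d where "d = r * (1 - q) / 2"
  have "0 < d" using \<open>0 < r\<close> \<open>q < 1\<close> by (simp add: d_def)
  with \<open>e \<longlonglongrightarrow> 0\<close> have "eventually (\<lambda>n. e n < d) sequentially"
    by (rule order_tendstoD)
  with step have "eventually (\<lambda>n. y (Suc n) \<le> q * y n + d) sequentially"
    by eventually_elim linarith
  then obtain N where N: "\<And>n. n \<ge> N \<Longrightarrow> y (Suc n) \<le> q * y n + d"
    by (auto simp: eventually_sequentially)
  have geom: "y (N + k) \<le> q ^ k * y N + r / 2" for k
  proof (induction k)
    case 0
    then show ?case using \<open>0 < r\<close> by simp
  next
    case (Suc k)
    have "y (N + Suc k) \<le> q * y (N + k) + d" using N[of "N + k"] by simp
    also have "\<dots> \<le> q * (q ^ k * y N + r / 2) + d"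
      using Suc \<open>0 \<le> q\<close> by (simp add: mult_left_mono)
    also have "\<dots> = q ^ Suc k * y N + r / 2" by (simp add: d_def field_simps)
    finally show ?case .
  qed
  have "(\<lambda>k. q ^ k * y N) \<longlonglongrightarrow> 0"
    using \<open>0 \<le> q\<close> \<open>q < 1\<close> by (intro tendsto_mult_left_zero LIMSEQ_realpow_zero)
  then have "eventually (\<lambda>k. q ^ k * y N < r / 2) sequentially"
    by (rule order_tendstoD) (use \<open>0 < r\<close> in simp)
  then obtain K where K: "\<And>k. k \<ge> K \<Longrightarrow> q ^ k * y N < r / 2"
    by (auto simp: eventually_sequentially)
  show "\<exists>M. \<forall>n\<ge>M. norm (y n - 0) < r"
  proof (intro exI allI impI)
    fix n assume "n \<ge> N + K"
    then have n: "N + (n - N) = n" "n - N \<ge> K" by simp_all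
    have "y n < r" using geom[of "n - N"] K[OF n(2)] unfolding n(1) by simp
    then show "norm (y n - 0) < r" using assms(1)[of n] by simp
  qed
qed

lemma tendsto_affine_recurrence:
  fixes x r w :: "nat \<Rightarrow> 'a :: real_normed_field"
  assumes step: "eventually (\<lambda>n. x (Suc n) = r n * x n + w n) sequentially"
    and r: "r \<longlonglongrightarrow> \<rho>" and "norm \<rho> < 1" and w: "w \<longlonglongrightarrow> \<omega>"
  shows "x \<longlonglongrightarrow> \<omega> / (1 - \<rho>)"
proof -
  define L where "L = \<omega> / (1 - \<rho>)"
  \<comment> \<open>\<open>L\<close> is the fixed point of the limiting map, so the residual
    \<open>e n\<close> that it leaves in the n-th recurrence tends to 0, and the distance from
    \<open>x n\<close> to \<open>L\<close> obeys a real contraction.\<close>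
  define e where "e n = w n + r n * L - L" for n
  have "1 - \<rho> \<noteq> 0" using \<open>norm \<rho> < 1\<close> by auto
  then have "L * (1 - \<rho>) = \<omega>" by (simp add: L_def)
  then have L: "\<omega> + \<rho> * L - L = 0" by (auto simp: algebra_simps)
  have "e \<longlonglongrightarrow> \<omega> + \<rho> * L - L" unfolding e_def by (intro tendsto_intros r w)
  then have e: "(\<lambda>n. norm (e n)) \<longlonglongrightarrow> 0" unfolding L by (rule tendsto_norm_zero)
  obtain q where q: "norm \<rho> < q" "q < 1" using dense[OF \<open>norm \<rho> < 1\<close>] by blast
  have "eventually (\<lambda>n. norm (r n) < q) sequentially"
    using tendsto_norm[OF r] q(1) by (rule order_tendstoD)
  with step
  have contr: "eventually (\<lambda>n. norm (x (Suc n) - L) \<le> q * norm (x n - L) + norm (e n)) sequentially"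
  proof eventually_elim
    case (elim n)
    have "x (Suc n) - L = r n * (x n - L) + e n"
      unfolding elim(1) by (simp add: e_def algebra_simps)
    then have "norm (x (Suc n) - L) \<le> norm (r n) * norm (x n - L) + norm (e n)"
      using norm_triangle_ineq[of "r n * (x n - L)" "e n"] by (simp add: norm_mult)
    also have "\<dots> \<le> q * norm (x n - L) + norm (e n)"
      using elim(2) by (intro add_right_mono mult_right_mono) auto
    finally show ?case .
  qed
  have "0 \<le> q" using q(1) norm_ge_zero[of \<rho>] by linarith
  from norm_ge_zero \<open>0 \<le> q\<close> q(2) contr e have "(\<lambda>n. norm (x n - L)) \<longlonglongrightarrow> 0"
    by (rule tendsto_zero_of_contraction)
  then show ?thesis unfolding tendsto_norm_zero_iff LIM_zero_iff L_def .
qed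

section \<open>Limits of \<open>varkappa\<close> and of the phase increments\<close>

lemma jacobi_coeffs_pos:
  assumes "jacobi_coeffs a" "k \<ge> -1"
  shows "a k > 0"
proof (cases "k = -1")
  case False
  with assms(2) obtain n where "k = int n" using zero_le_imp_eq_int[of k] by auto
  with assms(1) show ?thesis by (simp add: jacobi_coeffs_def)
qed (use assms in \<open>simp add: jacobi_coeffs_def\<close>)

text \<open>Telescoping: for \<open>i > 0\<close>, \<open>jk a i\<close> is the quotient of
  \<open>varkappa a (i - 1)\<close> by \<open>varkappa a i\<close>. Convergence of
  \<open>varkappa\<close> thereby becomes convergence of an infinite product.\<close>

lemma varkappa_prod:
  assumes "jacobi_coeffs a"
  shows "varkappa a n * (\<Prod>i\<le>n. jk a i) = sqrt (a 0 / a (-1))"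
proof -
  note pos = jacobi_coeffs_pos[OF assms]
  have step: "varkappa a i * jk a i = sqrt (a (int i) / a (int i - 1))" for i
  proof -
    have p: "a (int i) > 0" "a (int i - 1) > 0" "a (int i + 1) > 0" by (simp_all add: pos)
    have "varkappa a i * jk a i = sqrt (a (int i)) ^ 2 / (sqrt (a (int i)) * sqrt (a (int i - 1)))"
      using p unfolding varkappa_def jk_def
      by (simp add: real_sqrt_divide real_sqrt_mult)
    also have "\<dots> = sqrt (a (int i) / a (int i - 1))"
      using p by (simp add: real_sqrt_divide power2_eq_square del: real_sqrt_mult_self)
    finally show ?thesis .
  qed
  show ?thesis
  proof (induction n)
    case 0
    then show ?case using step[of 0] by simp
  next
    case (Suc n)
    have "varkappa a (Suc n) * (\<Prod>i\<le>Suc n. jk a i)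
        = (varkappa a (Suc n) * jk a (Suc n)) * (\<Prod>i\<le>n. jk a i)" by simp
    also have "varkappa a (Suc n) * jk a (Suc n) = varkappa a n"
      unfolding step by (simp add: varkappa_def add.commute)
    finally show ?case using Suc by simp
  qed
qed

text \<open>\<open>varkappa_inf\<close> is a \<open>lim\<close>, so convergence has to be
  established before it can be used. Summability makes the product of the \<open>jk a i\<close>
  converge absolutely, and positive factors keep its value away from 0, which permits division in
  \<open>varkappa_prod\<close>.\<close>

lemma varkappa_tendsto:
  assumes a: "jacobi_coeffs a" and k: "summable (\<lambda>n. \<bar>jk a n - 1\<bar>)"
  shows "varkappa a \<longlonglongrightarrow> varkappa_inf a"
proof -
  note pos = jacobi_coeffs_pos[OF a]
  have jk_pos: "jk a i > 0" for i
    unfolding jk_def by (intro divide_pos_pos) (simp_all add: pos)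
  have "abs_convergent_prod (jk a)"
    using k by (simp add: abs_convergent_prod_conv_summable)
  then have conv: "convergent_prod (jk a)" by (rule abs_convergent_prod_imp_convergent_prod)
  then have "(\<lambda>n. \<Prod>i\<le>n. jk a i) \<longlonglongrightarrow> prodinf (jk a)" by (rule convergent_prod_LIMSEQ)
  moreover have "prodinf (jk a) \<noteq> 0"
    using conv jk_pos by (intro prodinf_nonzero) (auto simp: less_imp_neq[symmetric])
  ultimately have "(\<lambda>n. sqrt (a 0 / a (-1)) / (\<Prod>i\<le>n. jk a i))
      \<longlonglongrightarrow> sqrt (a 0 / a (-1)) / prodinf (jk a)"
    by (intro tendsto_divide tendsto_const)
  moreover have "sqrt (a 0 / a (-1)) / (\<Prod>i\<le>n. jk a i) = varkappa a n" for n
    using prod_pos[of "{..n}" "jk a"] jk_pos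
    unfolding varkappa_prod[OF a, of n, symmetric]
    by (metis less_irrefl nonzero_mult_div_cancel_right)
  ultimately have "varkappa a \<longlonglongrightarrow> sqrt (a 0 / a (-1)) / prodinf (jk a)" by simp
  then show ?thesis unfolding varkappa_inf_def by (simp add: limI)
qed

text \<open>From some index on all \<open>\<bar>jbeta a b n\<bar>\<close> exceed 1, so the index set
  in \<open>phase\<close> gains exactly \<open>n\<close> and the increment is a single
  \<open>arcosh\<close> term.\<close>

lemma phase_increment_tendsto:
  assumes "jbeta a b \<longlonglongrightarrow> \<beta>" "\<bar>\<beta>\<bar> > 1"
  shows "(\<lambda>n. phase a b (Suc n) - phase a b n) \<longlonglongrightarrow> arcosh \<bar>\<beta>\<bar>"
proof -
  have abs: "(\<lambda>n. \<bar>jbeta a b n\<bar>) \<longlonglongrightarrow> \<bar>\<beta>\<bar>" using assms(1) by (rule tendsto_rabs)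
  then have "(\<lambda>n. arcosh \<bar>jbeta a b n\<bar>) \<longlonglongrightarrow> arcosh \<bar>\<beta>\<bar>"
    using assms(2) by (intro tendsto_arcosh)
  moreover have "eventually (\<lambda>n. \<bar>jbeta a b n\<bar> > 1) sequentially"
    using abs assms(2) by (rule order_tendstoD)
  then have "eventually (\<lambda>n. arcosh \<bar>jbeta a b n\<bar> = phase a b (Suc n) - phase a b n) sequentially"
  proof eventually_elim
    case (elim n)
    have "{m. m < Suc n \<and> \<bar>jbeta a b m\<bar> \<ge> 1} = insert n {m. m < n \<and> \<bar>jbeta a b m\<bar> \<ge> 1}"
      using elim by (auto simp: less_Suc_eq)
    then show ?case by (simp add: phase_def)
  qed
  ultimately show ?thesis by (rule Lim_transform_eventually)
qed

section \<open>Existence of the second solution\<close>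

text \<open>The Jacobi equation determines the value at \<open>n - 1\<close> from those at \<open>n\<close> and \<open>n + 1\<close>, so a
  solution near infinity extends backwards.\<close>

lemma jacobi_solution_extend:
  assumes a: "jacobi_coeffs a"
    and "\<And>n. n \<ge> N \<Longrightarrow> of_real (a (int n - 1)) * h (int n - 1) + of_real (b n) * h (int n)
        + of_real (a (int n)) * h (int n + 1) = z * h (int n)"
  shows "\<exists>g. jacobi_solution a b z g \<and> (\<forall>k \<ge> int N - 1. g k = h k)"
  using assms(2)
proof (induction N arbitrary: h)
  case 0
  then show ?case by (auto simp: jacobi_solution_def)
next
  case (Suc N)
  \<comment> \<open>The value at \<open>N - 1\<close> is obtained by solving the equation at
    \<open>N\<close>. The equations at larger indices do not involve it, so they survive the
    change.\<close>
  define h' where "h' = h(int N - 1 :=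
    (z * h (int N) - of_real (b N) * h (int N) - of_real (a (int N)) * h (int N + 1))
      / of_real (a (int N - 1)))"
  have "a (int N - 1) > 0" using jacobi_coeffs_pos[OF a] by simp
  then have "of_real (a (int n - 1)) * h' (int n - 1) + of_real (b n) * h' (int n)
      + of_real (a (int n)) * h' (int n + 1) = z * h' (int n)" if "n \<ge> N" for n
    using Suc.prems[of n] that by (cases "n = N") (auto simp: h'_def)
  from Suc.IH[OF this] obtain g
    where "jacobi_solution a b z g" "\<And>k. k \<ge> int N - 1 \<Longrightarrow> g k = h' k" by blast
  then show ?case by (intro exI[of _ g]) (auto simp: h'_def)
qed

text \<open>Reduction of order: the increments of the sum are those for which the Wronskian
  \<open>a n * (f n * h (n + 1) - f (n + 1) * h n)\<close> equals 1 for \<open>n \<ge> n0\<close>.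
  Backward extension supplies the values below \<open>n0\<close>.\<close>

lemma second_solution_exists:
  assumes a: "jacobi_coeffs a" and f: "jacobi_solution a b z f"
    and nz: "\<forall>n \<ge> int n0 - 1. f n \<noteq> 0"
  shows "\<exists>g. second_solution a b z f n0 g"
proof -
  define S where
    "S n = (\<Sum>m=n0..n. inverse (of_real (a (int m - 1)) * f (int m - 1) * f (int m)))" for n
  have S_Suc: "S (Suc n) = S n + inverse (of_real (a (int n)) * f (int n) * f (int n + 1))"
    if "n \<ge> n0" for n using that by (simp add: S_def add.commute)
  define h where "h k = f k * S (nat k)" for k
  have "of_real (a (int n - 1)) * h (int n - 1) + of_real (b n) * h (int n)
      + of_real (a (int n)) * h (int n + 1) = z * h (int n)" if "n \<ge> Suc n0" for n
  proof -
    from that obtain p where p: "n = Suc p" "p \<ge> n0" by (cases n) auto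
    define A B where "A = complex_of_real (a (int p))" and "B = complex_of_real (a (int p + 1))"
    define u v w where "u = f (int p)" and "v = f (int p + 1)" and "w = f (int p + 2)"
    have "a (int p) > 0" "a (int p + 1) > 0" using jacobi_coeffs_pos[OF a] by simp_all
    then have ne: "A \<noteq> 0" "B \<noteq> 0" "u \<noteq> 0" "v \<noteq> 0" "w \<noteq> 0"
      using p nz by (auto simp: A_def B_def u_def v_def w_def)
    have S1: "S (Suc p) = S p + inverse (A * u * v)"
      using S_Suc[of p] p by (simp add: A_def u_def v_def)
    have S2: "S (Suc (Suc p)) = S (Suc p) + inverse (B * v * w)"
      using S_Suc[of "Suc p"] p by (simp add: B_def v_def w_def ac_simps)
    have eq: "A * u + of_real (b n) * v + B * w = z * v"
      using f[unfolded jacobi_solution_def, rule_format, of n] p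
      by (simp add: A_def B_def u_def v_def w_def ac_simps)
    \<comment> \<open>Expanding around the middle sum \<open>S (Suc p)\<close> leaves the equation
      for \<open>f\<close> and two corrections, both equal to \<open>1 / v\<close> in size and
      opposite in sign.\<close>
    have "A * (u * S p) + of_real (b n) * (v * S (Suc p)) + B * (w * S (Suc (Suc p)))
        = (A * u + of_real (b n) * v + B * w) * S (Suc p)
          - A * u * inverse (A * u * v) + B * w * inverse (B * v * w)"
      unfolding S2 by (simp add: S1 algebra_simps)
    also have "\<dots> = z * (v * S (Suc p))" using ne unfolding eq by (simp add: field_simps)
    finally show ?thesis
      by (simp add: p h_def A_def B_def u_def v_def w_def nat_add_distrib ac_simps)
  qed
  from jacobi_solution_extend[OF a, where N = "Suc n0" and h = h, OF this] obtain g
    where "jacobi_solution a b z g" "\<And>k. k \<ge> int n0 \<Longrightarrow> g k = h k" by auto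
  then show ?thesis
    by (intro exI[of _ g]) (simp add: second_solution_def h_def S_def)
qed

section \<open>Asymptotics of the second solution\<close>

lemma second_solution_asymptotics:
  assumes a: "jacobi_coeffs a" and \<beta>: "jbeta a b \<longlonglongrightarrow> \<beta>" "\<bar>\<beta>\<bar> > 1"
    and k: "summable (\<lambda>n. \<bar>jk a n - 1\<bar>)"
    and f: "jost_solution a b \<beta> z f" and g: "second_solution a b z f n0 g"
  shows "(\<lambda>n::nat. of_real (sqrt (a (int n)) * exp (- phase a b n) * sgn \<beta> ^ n) * g (int n))
      \<longlonglongrightarrow> of_real (sgn \<beta> / (2 * sqrt (\<beta>\<^sup>2 - 1)) * varkappa_inf a)"
proof -
  define s where "s = sgn \<beta>"
  have "s \<noteq> 0" and ss: "s * s = 1" using \<beta>(2) by (auto simp: s_def sgn_if)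
  have ss_pow: "s ^ n * s ^ n = 1" for n by (simp add: ss flip: power_mult_distrib)
  define \<alpha> where "\<alpha> n = sqrt (a (int n))" for n
  have \<alpha>: "\<alpha> n > 0" "a (int n) = \<alpha> n * \<alpha> n" for n
    using jacobi_coeffs_pos[OF a, of "int n"] by (simp_all add: \<alpha>_def)
  define E where "E n = exp (- phase a b n)" for n
  have E: "E n > 0" for n by (simp add: E_def)
  define \<theta> where "\<theta> n = phase a b (Suc n) - phase a b n" for n
  have E_Suc: "E (Suc n) = E n * exp (- \<theta> n)" for n
    by (simp add: E_def \<theta>_def flip: exp_add)
  have \<theta>: "\<theta> \<longlonglongrightarrow> arcosh \<bar>\<beta>\<bar>" unfolding \<theta>_def by (rule phase_increment_tendsto[OF \<beta>])
  define G where "G n = s ^ n * E n / \<alpha> n" for n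
  have G0: "G n \<noteq> 0" for n using \<open>s \<noteq> 0\<close> E[of n] \<alpha>(1)[of n] by (simp add: G_def)
  \<comment> \<open>\<open>G\<close> is the leading term of the Jost solution, and \<open>p\<close>
    is the relative correction, which tends to 1.\<close>
  define p where "p n = f (int n) / of_real (G n)" for n
  have fp: "f (int n) = of_real (G n) * p n" for n using G0 by (simp add: p_def)
  have "a (int n) powr (-1/2) * s ^ n * exp (- phase a b n) = G n" for n
    using \<alpha>(1)[of n] jacobi_coeffs_pos[OF a, of "int n"]
    by (simp add: G_def E_def \<alpha>_def powr_minus_divide powr_half_sqrt)
  then have "(\<lambda>n. f (int n)) \<sim>[sequentially] (\<lambda>n. of_real (G n))"
    using f by (simp add: jost_solution_def s_def)
  then have p: "p \<longlonglongrightarrow> 1"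
    unfolding p_def by (rule asymp_equivD_strong) (simp add: G0)
  have p': "(\<lambda>n. p (Suc n)) \<longlonglongrightarrow> 1" using p by (rule LIMSEQ_Suc)

  define S where
    "S n = (\<Sum>m=n0..n. inverse (of_real (a (int m - 1)) * f (int m - 1) * f (int m)))" for n
  define x where "x n = of_real (E n * E n) * S n" for n
  define r where "r n = complex_of_real (exp (- \<theta> n) * exp (- \<theta> n))" for n
  define w where "w n = of_real (s * varkappa a n * exp (- \<theta> n)) / (p n * p (Suc n))" for n
  have "x (Suc n) = r n * x n + w n" if "n \<ge> n0" for n
  proof -
    have vk: "varkappa a n = \<alpha> (Suc n) / \<alpha> n"
      by (simp add: varkappa_def \<alpha>_def real_sqrt_divide add.commute)
    \<comment> \<open>One factor \<open>E (Suc n) / E n\<close> remains and gives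
      \<open>exp (- \<theta> n)\<close>; the square roots leave the ratio defining
      \<open>varkappa\<close>. The sign moves from denominator to numerator because \<open>s\<close>
      is 1 or -1.\<close>
    have EE: "E (Suc n) * E (Suc n) / (a (int n) * G n * G (Suc n))
        = s * (\<alpha> (Suc n) / \<alpha> n) * exp (- \<theta> n)"
    proof -
      have "G n * G (Suc n) = s * E n * E (Suc n) / (\<alpha> n * \<alpha> (Suc n))"
        using ss_pow[of n] by (simp add: G_def)
      then have "a (int n) * G n * G (Suc n) = s * E n * E (Suc n) * \<alpha> n / \<alpha> (Suc n)"
        using \<alpha>(1)[of n] by (simp add: \<alpha>(2) mult.assoc)
      moreover have "s = 1 \<or> s = -1" using ss by (simp add: square_eq_1_iff)
      ultimately show ?thesis
        using E[of n] by (elim disjE) (simp_all add: E_Suc)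
    qed
    have "w n = of_real (E (Suc n) * E (Suc n) / (a (int n) * G n * G (Suc n)))
        / (p n * p (Suc n))"
      by (simp only: w_def vk EE)
    also have "\<dots> = of_real (E (Suc n) * E (Suc n))
        * inverse (of_real (a (int n)) * f (int n) * f (int (Suc n)))"
      unfolding fp by (simp add: divide_inverse ac_simps)
    finally have w_n: "w n = of_real (E (Suc n) * E (Suc n))
        * inverse (of_real (a (int n)) * f (int n) * f (int (Suc n)))" .
    have "S (Suc n) = S n + inverse (of_real (a (int n)) * f (int n) * f (int (Suc n)))"
      using that by (simp add: S_def)
    then have "x (Suc n) = of_real (E (Suc n) * E (Suc n)) * S n + w n"
      by (simp only: x_def w_n distrib_left)
    also have "of_real (E (Suc n) * E (Suc n)) * S n = r n * x n"
      by (simp add: x_def r_def E_Suc)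
    finally show ?thesis .
  qed
  then have step: "eventually (\<lambda>n. x (Suc n) = r n * x n + w n) sequentially"
    by (rule eventually_sequentiallyI)

  define q where "q = exp (- arcosh \<bar>\<beta>\<bar>)"
  have "0 < q" by (simp add: q_def)
  \<comment> \<open>Here \<open>\<bar>\<beta>\<bar> > 1\<close> enters strictly:
    \<open>arcosh\<close> is positive, so the limiting ratio \<open>q * q\<close> is a
    contraction.\<close>
  have "q < 1" using \<beta>(2) by (simp add: q_def)
  then have qq: "q * q < 1" using \<open>0 < q\<close> mult_strict_mono[of q 1 q 1] by simp
  have q: "(\<lambda>n. exp (- \<theta> n)) \<longlonglongrightarrow> q" unfolding q_def by (intro tendsto_intros \<theta>)
  have r: "r \<longlonglongrightarrow> of_real (q * q)" unfolding r_def by (intro tendsto_intros q)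
  have "w \<longlonglongrightarrow> of_real (s * varkappa_inf a * q) / (1 * 1)"
    unfolding w_def by (intro tendsto_intros q p p' varkappa_tendsto[OF a k]) simp
  then have w: "w \<longlonglongrightarrow> of_real (s * varkappa_inf a * q)" by simp
  have "x \<longlonglongrightarrow> of_real (s * varkappa_inf a * q) / (1 - of_real (q * q))"
    using qq by (intro tendsto_affine_recurrence[OF step r _ w]) (simp add: norm_mult)
  then have lim: "(\<lambda>n. p n * x n)
      \<longlonglongrightarrow> 1 * (of_real (s * varkappa_inf a * q) / (1 - of_real (q * q)))"
    by (intro tendsto_mult p)

  \<comment> \<open>The fixed point is \<open>q / (1 - q * q)\<close> times
    \<open>s * varkappa_inf a\<close>, and \<open>(1 - q * q) / q\<close> is twice
    \<open>sinh (arcosh \<bar>\<beta>\<bar>)\<close>.\<close>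
  have "sqrt (\<beta>\<^sup>2 - 1) = sinh (arcosh \<bar>\<beta>\<bar>)" using \<beta>(2) by (simp add: sinh_arcosh_real)
  also have "\<dots> = (inverse q - q) / 2" by (simp add: sinh_def q_def exp_minus)
  finally have "2 * sqrt (\<beta>\<^sup>2 - 1) = (1 - q * q) / q"
    using \<open>0 < q\<close> by (simp add: field_simps)
  then have "s * varkappa_inf a * q / (1 - q * q)
      = sgn \<beta> / (2 * sqrt (\<beta>\<^sup>2 - 1)) * varkappa_inf a"
    by (simp add: s_def)
  then have L: "1 * (of_real (s * varkappa_inf a * q) / (1 - of_real (q * q)))
      = complex_of_real (sgn \<beta> / (2 * sqrt (\<beta>\<^sup>2 - 1)) * varkappa_inf a)"
    by (metis mult_1 of_real_1 of_real_diff of_real_divide)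
  have "p n * x n
      = of_real (sqrt (a (int n)) * exp (- phase a b n) * sgn \<beta> ^ n) * g (int n)" if "n \<ge> n0" for n
  proof -
    \<comment> \<open>The normalisation of \<open>g\<close> times \<open>G n\<close> is exactly the
      weight \<open>E n * E n\<close> in \<open>x n\<close>, so the normalised \<open>g\<close>
      equals \<open>p n * x n\<close> without error.\<close>
    have "\<alpha> n * E n * s ^ n * G n = E n * E n * (s ^ n * s ^ n)"
      using \<alpha>(1)[of n] by (simp add: G_def)
    then have EE: "\<alpha> n * E n * s ^ n * G n = E n * E n" by (simp add: ss_pow)
    have "g (int n) = of_real (G n) * p n * S n"
      using g that by (simp add: second_solution_def S_def flip: fp)
    then have "of_real (\<alpha> n * E n * s ^ n) * g (int n)
        = of_real (\<alpha> n * E n * s ^ n * G n) * (p n * S n)"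
      by (simp add: mult.assoc)
    then have "of_real (\<alpha> n * E n * s ^ n) * g (int n) = p n * x n"
      unfolding EE x_def by (simp only: ac_simps)
    then show ?thesis by (simp add: \<alpha>_def E_def s_def)
  qed
  then have "eventually (\<lambda>n. p n * x n
      = of_real (sqrt (a (int n)) * exp (- phase a b n) * sgn \<beta> ^ n) * g (int n)) sequentially"
    by (rule eventually_sequentiallyI)
  with lim show ?thesis unfolding L by (rule Lim_transform_eventually)
qed

theorem theorem4p13:
  fixes a :: "int \<Rightarrow> real" and b :: "nat \<Rightarrow> real" and \<beta>inf :: real
    and z :: complex and f :: "int \<Rightarrow> complex" and n0 :: nat
  assumes "jacobi_coeffs a"
    and "summable (\<lambda>n::nat. inverse (a (int n)))"
    and "jbeta a b \<longlonglongrightarrow> \<beta>inf" and "\<bar>\<beta>inf\<bar> > 1"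
    and "summable (\<lambda>n. \<bar>jk a n - 1\<bar>)"
    and "summable (\<lambda>n. \<bar>jbeta a b (n + 1) - jbeta a b n\<bar>)"
    and "jost_solution a b \<beta>inf z f"
    and "n0 \<ge> 1" and "\<forall>n \<ge> int n0 - 1. f n \<noteq> 0"
  shows "(\<exists>g. second_solution a b z f n0 g) \<and>
    (\<forall>g. second_solution a b z f n0 g \<longrightarrow>
      (\<lambda>n::nat. of_real (sqrt (a (int n)) * exp (- phase a b n) * sgn \<beta>inf ^ n) * g (int n))
        \<longlonglongrightarrow> of_real (sgn \<beta>inf / (2 * sqrt (\<beta>inf\<^sup>2 - 1)) * varkappa_inf a))"
proof (intro conjI allI impI)
  \<comment> \<open>Existence keeps the claim about all such \<open>g\<close> from being
    vacuous.\<close>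
  show "\<exists>g. second_solution a b z f n0 g"
    using second_solution_exists[OF assms(1) _ assms(9)] assms(7)
    unfolding jost_solution_def by (elim conjE)
qed (rule second_solution_asymptotics[OF assms(1,3-5,7)])

end
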